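(* There exists a universal constant $c>0$ such that the following holds for all positive integers $n$. If $\mathcal{A} \subset \mathcal{P}_n$ is a symmetric $3$-wise intersecting family, then $|\mathcal{A}| \le 2^n / n^c$.
   Context: For a positive integer $n$, write $[n]=\{1,2,\dots,n\}$, let $S_n$ be the symmetric group on $[n]$, and let $\mathcal{P}_n$ be the power-set of $[n]$. The notation $\mathcal{A}\subset\mathcal{P}_n$ allows equality. For $\sigma\in S_n$ and $x\subset[n]$, $\sigma(x)$ denotes the image of $x$ under $\sigma$, and for $\mathcal{A}\subset\mathcal{P}_n$, $\sigma(\mathcal{A})=\{\sigma(x):x\in\mathcal{A}\}$. The automorphism group of $\mathcal{A}$ is $\operatorname{Aut}(\mathcal{A})=\{\sigma\in S_n:\sigma(\mathcal{A})=\mathcal{A}\}$. The family $\mathcal{A}$ is symmetric if $\operatorname{Aut}(\mathcal{A})$ is a transitive subgroup of $S_n$, i.e., for all $i,j\in[n]$ there exists $\sigma\in\operatorname{Aut}(\mathcal{A})$ with $\sigma(i)=j$. The family $\mathcal{A}$ is $3$-wise intersecting if $x_1\cap x_2\cap x_3\neq\emptyset$ for all $x_1,x_2,x_3\in\mathcal{A}$ (not necessarily distinct). *)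

theory Defs
  imports Complex_Main "HOL-Combinatorics.Permutations"
begin

(* A member of S_n is a function nat => nat that permutes {1..n}; it fixes every
   number outside {1..n}. *)
definition aut_family :: "nat \<Rightarrow> nat set set \<Rightarrow> (nat \<Rightarrow> nat) set" where
  "aut_family n A = {\<sigma>. \<sigma> permutes {1..n} \<and> (\<lambda>x. \<sigma> ` x) ` A = A}"

definition symmetric_family :: "nat \<Rightarrow> nat set set \<Rightarrow> bool" where
  "symmetric_family n A \<longleftrightarrow>
     (\<forall>i\<in>{1..n}. \<forall>j\<in>{1..n}. \<exists>\<sigma>\<in>aut_family n A. \<sigma> i = j)"

(* The three members need not be distinct; in particular no member is empty. *)
definition three_wise_intersecting :: "nat set set \<Rightarrow> bool" where
  "three_wise_intersecting A \<longleftrightarrow>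
     (\<forall>x1\<in>A. \<forall>x2\<in>A. \<forall>x3\<in>A. x1 \<inter> x2 \<inter> x3 \<noteq> {})"

end

theory Submission
  imports Defs
begin

text \<open>
  Replace the family by its up-closure \<open>F\<close> and expand its indicator function in Walsh characters.
  If \<open>x\<close>, \<open>y\<close> are in \<open>F\<close>, then their symmetric difference is not, since the three sets have empty
  intersection; on the Fourier side this says that the sum of the cubes of the coefficients
  vanishes, so some coefficient other than the one at the empty set is large. As \<open>F\<close> is an up-set,
  the coefficient at \<open>S\<close> is at most the influence of each element of \<open>S\<close>. By symmetry all
  influences are equal, and they are the coefficients at singletons, so by Parseval they are small.
  Comparing the two bounds gives the exponent \<open>1/3\<close>.
\<close>

section \<open>Walsh characters and the identities for sums of squares and cubes\<close>

definition walsh :: "'a set \<Rightarrow> 'a set \<Rightarrow> real" where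
  "walsh S x = (\<Prod>i\<in>S. if i \<in> x then - 1 else 1)"

text \<open>Unnormalised: for families of subsets of an \<open>n\<close>-element set this is
  \<open>2 ^ n\<close> times the usual coefficient of the indicator function, so the ground set is
  not an argument.\<close>

definition fourier_coeff :: "'a set set \<Rightarrow> 'a set \<Rightarrow> real" where
  "fourier_coeff F S = (\<Sum>x\<in>F. walsh S x)"

text \<open>Only the upper member of each boundary pair in direction \<open>i\<close> is recorded.
  For an up-set in an \<open>n\<close>-element ground set containing \<open>i\<close>, the
  cardinality is the influence of \<open>i\<close> times \<open>2 ^ (n - 1)\<close>.\<close>

definition pivotal :: "'a set set \<Rightarrow> 'a \<Rightarrow> 'a set set" where
  "pivotal F i = {x \<in> F. i \<in> x \<and> x - {i} \<notin> F}"

lemma walsh_empty [simp]: "walsh {} x = 1"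
  by (simp add: walsh_def)

lemma abs_walsh [simp]: "\<bar>walsh S x\<bar> = 1"
  unfolding walsh_def abs_prod by (rule prod.neutral) auto

lemma walsh_sym_diff: "walsh S (sym_diff x y) = walsh S x * walsh S y"
  unfolding walsh_def prod.distrib [symmetric] by (rule prod.cong) auto

lemma walsh_insert:
  assumes "finite S" "i \<in> S" "i \<notin> x"
  shows "walsh S (insert i x) = - walsh S x"
proof -
  have "(\<Prod>j\<in>S - {i}. if j \<in> insert i x then - 1 else 1) = (\<Prod>j\<in>S - {i}. if j \<in> x then - 1 else (1::real))"
    by (rule prod.cong) auto
  then show ?thesis
    using assms by (simp add: walsh_def prod.remove)
qed

text \<open>Orthogonality, summed over the characters instead of the points: if \<open>i\<close>
  lies in \<open>x\<close>, adding \<open>i\<close> to \<open>S\<close> flips the sign, so the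
  subsets of \<open>V\<close> cancel in pairs.\<close>

lemma sum_walsh_Pow:
  assumes "finite V" "x \<subseteq> V"
  shows "(\<Sum>S\<in>Pow V. walsh S x) = (if x = {} then 2 ^ card V else 0)"
proof (cases "x = {}")
  case True
  then show ?thesis
    using assms by (simp add: walsh_def card_Pow)
next
  case False
  then obtain i where i: "i \<in> x" by blast
  define W where "W = V - {i}"
  have V: "V = insert i W" "i \<notin> W" "finite W"
    using i assms by (auto simp: W_def)
  have "(\<Sum>S\<in>Pow V. walsh S x) = (\<Sum>S\<in>Pow W. walsh S x) + (\<Sum>S\<in>insert i ` Pow W. walsh S x)"
    unfolding V Pow_insert using V by (intro sum.union_disjoint) auto
  also have "(\<Sum>S\<in>insert i ` Pow W. walsh S x) = (\<Sum>S\<in>Pow W. walsh (insert i S) x)"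
    using V by (subst sum.reindex) (auto simp: inj_on_def)
  also have "\<dots> = (\<Sum>S\<in>Pow W. - walsh S x)"
  proof (rule sum.cong)
    fix S assume "S \<in> Pow W"
    then have "finite S" "i \<notin> S"
      using V by (auto intro: finite_subset)
    then show "walsh (insert i S) x = - walsh S x"
      using i by (simp add: walsh_def)
  qed simp
  finally show ?thesis
    using False by (simp add: sum_negf)
qed

lemma fourier_coeff_empty [simp]: "fourier_coeff F {} = card F"
  by (simp add: fourier_coeff_def)

text \<open>Expanding the square gives a sum over pairs \<open>x\<close>, \<open>y\<close>, in which
  orthogonality keeps only the diagonal.\<close>

lemma parseval:
  assumes "finite V" "F \<subseteq> Pow V"
  shows "(\<Sum>S\<in>Pow V. (fourier_coeff F S)\<^sup>2) = 2 ^ card V * card F"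
proof -
  have fin: "finite F"
    using assms finite_subset by blast
  have "(\<Sum>S\<in>Pow V. (fourier_coeff F S)\<^sup>2) = (\<Sum>S\<in>Pow V. \<Sum>x\<in>F. \<Sum>y\<in>F. walsh S (sym_diff x y))"
    by (simp add: fourier_coeff_def power2_eq_square sum_product walsh_sym_diff)
  also have "\<dots> = (\<Sum>x\<in>F. \<Sum>S\<in>Pow V. \<Sum>y\<in>F. walsh S (sym_diff x y))"
    by (rule sum.swap)
  also have "\<dots> = (\<Sum>x\<in>F. \<Sum>y\<in>F. \<Sum>S\<in>Pow V. walsh S (sym_diff x y))"
    by (rule sum.cong [OF refl sum.swap])
  also have "\<dots> = (\<Sum>x\<in>F. \<Sum>y\<in>F. if x = y then 2 ^ card V else 0)"
  proof (intro sum.cong refl)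
    fix x y assume "x \<in> F" "y \<in> F"
    then have "sym_diff x y \<subseteq> V"
      using assms by blast
    moreover have "sym_diff x y = {} \<longleftrightarrow> x = y"
      by blast
    ultimately show "(\<Sum>S\<in>Pow V. walsh S (sym_diff x y)) = (if x = y then 2 ^ card V else 0)"
      by (simp add: sum_walsh_Pow [OF assms(1)])
  qed
  also have "\<dots> = 2 ^ card V * card F"
    using fin by simp
  finally show ?thesis .
qed

text \<open>By orthogonality the expanded cube counts, up to the factor \<open>2 ^ card V\<close>,
  the triples in \<open>F\<close> with \<open>z = sym_diff x y\<close>; the hypothesis excludes them
  all.\<close>

lemma sum_cubes_eq_0:
  assumes "finite V" "F \<subseteq> Pow V"
    and no_triangle: "\<And>x y. x \<in> F \<Longrightarrow> y \<in> F \<Longrightarrow> sym_diff x y \<notin> F"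
  shows "(\<Sum>S\<in>Pow V. fourier_coeff F S ^ 3) = 0"
proof -
  have "(\<Sum>S\<in>Pow V. fourier_coeff F S ^ 3)
      = (\<Sum>S\<in>Pow V. \<Sum>x\<in>F. \<Sum>y\<in>F. \<Sum>z\<in>F. walsh S (sym_diff (sym_diff x y) z))"
    by (simp add: fourier_coeff_def power3_eq_cube sum_product walsh_sym_diff sum_distrib_right
        sum_distrib_left mult_ac)
  also have "\<dots> = (\<Sum>x\<in>F. \<Sum>S\<in>Pow V. \<Sum>y\<in>F. \<Sum>z\<in>F. walsh S (sym_diff (sym_diff x y) z))"
    by (rule sum.swap)
  also have "\<dots> = (\<Sum>x\<in>F. \<Sum>y\<in>F. \<Sum>S\<in>Pow V. \<Sum>z\<in>F. walsh S (sym_diff (sym_diff x y) z))"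
    by (rule sum.cong [OF refl sum.swap])
  also have "\<dots> = (\<Sum>x\<in>F. \<Sum>y\<in>F. \<Sum>z\<in>F. \<Sum>S\<in>Pow V. walsh S (sym_diff (sym_diff x y) z))"
    by (intro sum.cong refl sum.swap)
  also have "\<dots> = (\<Sum>x\<in>F. \<Sum>y\<in>F. \<Sum>z\<in>F. 0)"
  proof (intro sum.cong refl)
    fix x y z assume xyz: "x \<in> F" "y \<in> F" "z \<in> F"
    then have "sym_diff (sym_diff x y) z \<subseteq> V"
      using assms(2) by blast
    moreover have "sym_diff x y \<noteq> z"
      using no_triangle xyz by blast
    then have "sym_diff (sym_diff x y) z \<noteq> {}"
      by blast
    ultimately show "(\<Sum>S\<in>Pow V. walsh S (sym_diff (sym_diff x y) z)) = 0"
      by (simp add: sum_walsh_Pow [OF assms(1)])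
  qed
  finally show ?thesis
    by simp
qed

section \<open>Fourier coefficients and influences of up-sets\<close>

lemma fourier_coeff_eq_sum_pivotal:
  assumes "finite F" "finite S" "i \<in> S" and up: "\<And>x. x \<in> F \<Longrightarrow> insert i x \<in> F"
  shows "fourier_coeff F S = (\<Sum>x\<in>pivotal F i. walsh S x)"
proof -
  \<comment> \<open>The members outside \<open>pivotal F i\<close> pair up as \<open>x\<close> and
    \<open>insert i x\<close> with \<open>x\<close> in \<open>F0\<close>. As \<open>i\<close> lies
    in \<open>S\<close>, the two characters of a pair cancel.\<close>
  define F0 where "F0 = {x \<in> F. i \<notin> x}"
  have split: "F = pivotal F i \<union> (F0 \<union> insert i ` F0)"
  proof
    show "F \<subseteq> pivotal F i \<union> (F0 \<union> insert i ` F0)"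
    proof
      fix x assume x: "x \<in> F"
      consider "i \<notin> x" | "i \<in> x" "x - {i} \<notin> F" | "i \<in> x" "x - {i} \<in> F"
        by blast
      then show "x \<in> pivotal F i \<union> (F0 \<union> insert i ` F0)"
      proof cases
        case 3
        then have "x - {i} \<in> F0" "x = insert i (x - {i})"
          by (auto simp: F0_def)
        then show ?thesis by blast
      qed (use x in \<open>auto simp: F0_def pivotal_def\<close>)
    qed
    show "pivotal F i \<union> (F0 \<union> insert i ` F0) \<subseteq> F"
      using up by (auto simp: F0_def pivotal_def)
  qed
  have fin: "finite F0" "finite (pivotal F i)"
    using assms(1) by (auto simp: F0_def pivotal_def)
  have "fourier_coeff F S = (\<Sum>x\<in>pivotal F i \<union> (F0 \<union> insert i ` F0). walsh S x)"
    unfolding fourier_coeff_def using split by simp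
  also have "\<dots> = (\<Sum>x\<in>pivotal F i. walsh S x) + (\<Sum>x\<in>F0 \<union> insert i ` F0. walsh S x)"
    using fin by (intro sum.union_disjoint) (auto simp: F0_def pivotal_def)
  also have "(\<Sum>x\<in>F0 \<union> insert i ` F0. walsh S x)
      = (\<Sum>x\<in>F0. walsh S x) + (\<Sum>x\<in>insert i ` F0. walsh S x)"
    using fin by (intro sum.union_disjoint) (auto simp: F0_def)
  also have "(\<Sum>x\<in>insert i ` F0. walsh S x) = (\<Sum>x\<in>F0. walsh S (insert i x))"
    by (subst sum.reindex) (auto simp: inj_on_def F0_def)
  also have "\<dots> = (\<Sum>x\<in>F0. - walsh S x)"
    using assms by (intro sum.cong refl walsh_insert) (auto simp: F0_def)
  finally show ?thesis
    by (simp add: sum_negf)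
qed

lemma abs_fourier_coeff_le_card_pivotal:
  assumes "finite F" "finite S" "i \<in> S" "\<And>x. x \<in> F \<Longrightarrow> insert i x \<in> F"
  shows "\<bar>fourier_coeff F S\<bar> \<le> card (pivotal F i)"
  using sum_abs [of "walsh S" "pivotal F i"] fourier_coeff_eq_sum_pivotal [OF assms] by simp

text \<open>The preceding bound is attained at \<open>{i}\<close>: every pivotal set contains
  \<open>i\<close>, so all its characters are -1 and nothing cancels.\<close>

lemma fourier_coeff_singleton:
  assumes "finite F" "\<And>x. x \<in> F \<Longrightarrow> insert i x \<in> F"
  shows "fourier_coeff F {i} = - real (card (pivotal F i))"
proof -
  have "(\<Sum>x\<in>pivotal F i. walsh {i} x) = (\<Sum>x\<in>pivotal F i. - 1)"
    by (rule sum.cong) (auto simp: walsh_def pivotal_def)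
  then show ?thesis
    using fourier_coeff_eq_sum_pivotal [of F "{i}" i] assms by simp
qed

section \<open>Equal influences and the cubic bound\<close>

lemma card_pivotal_aut:
  assumes "inj \<sigma>" "(`) \<sigma> ` F = F"
  shows "card (pivotal F (\<sigma> i)) = card (pivotal F i)"
proof -
  have mem: "\<sigma> ` x \<in> F \<longleftrightarrow> x \<in> F" for x
    using assms by (metis image_eqI imageE inj_image_eq_iff)
  have diff: "\<sigma> ` x - {\<sigma> i} = \<sigma> ` (x - {i})" for x
    using assms(1) by (auto simp: inj_def)
  have "pivotal F (\<sigma> i) = (`) \<sigma> ` pivotal F i"
  proof (intro equalityI subsetI)
    fix y assume y: "y \<in> pivotal F (\<sigma> i)"
    then obtain x where x: "x \<in> F" "y = \<sigma> ` x"
      using assms(2) unfolding pivotal_def by blast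
    with y have "x \<in> pivotal F i"
      using assms(1) by (auto simp: pivotal_def diff mem inj_image_mem_iff)
    with x show "y \<in> (`) \<sigma> ` pivotal F i" by blast
  next
    fix y assume "y \<in> (`) \<sigma> ` pivotal F i"
    then show "y \<in> pivotal F (\<sigma> i)"
      using assms(1) by (auto simp: pivotal_def diff mem inj_image_mem_iff)
  qed
  moreover have "inj_on ((`) \<sigma>) (pivotal F i)"
    using assms(1) by (simp add: inj_on_def inj_image_eq_iff)
  ultimately show ?thesis
    by (simp add: card_image)
qed

text \<open>With \<open>a = card F\<close> and \<open>N = 2 ^ card V\<close>, the cubes give
  \<open>a\<^sup>2 \<le> b * N\<close> and the singletons give
  \<open>card V * b\<^sup>2 \<le> N * a\<close>; squaring the first eliminates
  \<open>b\<close>.\<close>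

lemma card_cube_le_of_equal_influences:
  assumes V: "finite V" "F \<subseteq> Pow V"
    and up: "\<And>x i. x \<in> F \<Longrightarrow> i \<in> V \<Longrightarrow> insert i x \<in> F"
    and no_triangle: "\<And>x y. x \<in> F \<Longrightarrow> y \<in> F \<Longrightarrow> sym_diff x y \<notin> F"
    and b: "\<And>i. i \<in> V \<Longrightarrow> card (pivotal F i) = b"
  shows "real (card V) * real (card F) ^ 3 \<le> (2 ^ card V) ^ 3"
\<comment> \<open>The empty family is set apart because a factor \<open>card F\<close> is cancelled
  twice below.\<close>
proof (cases "card F = 0")
  case False
  define a where "a = real (card F)"
  define N where "N = (2::real) ^ card V"
  have a: "a > 0" and N: "N > 0"
    using False by (simp_all add: a_def N_def)
  have fin: "finite F"
    using V finite_subset by blast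
  let ?g = "fourier_coeff F"
  have parseval: "(\<Sum>S\<in>Pow V. (?g S)\<^sup>2) = N * a"
    using parseval [OF V] by (simp add: a_def N_def)
  have bound: "\<bar>?g S\<bar> \<le> b" if "S \<in> Pow V - {{}}" for S
  proof -
    from that obtain i where "i \<in> S" by blast
    with that show ?thesis
      using abs_fourier_coeff_le_card_pivotal [of F S i] V fin up b finite_subset
      by (metis Diff_iff PowD subsetD)
  qed
  have "0 = (\<Sum>S\<in>Pow V. ?g S ^ 3)"
    using sum_cubes_eq_0 [OF V no_triangle] by simp
  also have "\<dots> = a ^ 3 + (\<Sum>S\<in>Pow V - {{}}. ?g S ^ 3)"
    using V(1) by (subst sum.remove [of _ "{}"]) (auto simp: a_def)
  finally have "a ^ 3 = (\<Sum>S\<in>Pow V - {{}}. - (?g S ^ 3))"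
    by (simp add: sum_negf)
  \<comment> \<open>Only one factor of the cube is bounded by \<open>b\<close>; the remaining square
    is left for Parseval, once the nonnegative term at the empty set is put back.\<close>
  also have "\<dots> \<le> (\<Sum>S\<in>Pow V - {{}}. b * (?g S)\<^sup>2)"
  proof (rule sum_mono)
    fix S assume "S \<in> Pow V - {{}}"
    then have "- ?g S \<le> b"
      using bound [of S] by linarith
    then have "- ?g S * (?g S)\<^sup>2 \<le> b * (?g S)\<^sup>2"
      by (rule mult_right_mono) simp
    then show "- (?g S ^ 3) \<le> b * (?g S)\<^sup>2"
      by (simp add: power3_eq_cube power2_eq_square)
  qed
  also have "\<dots> \<le> (\<Sum>S\<in>Pow V. b * (?g S)\<^sup>2)"
    using V(1) by (intro sum_mono2) auto
  also have "\<dots> = b * (N * a)"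
    by (simp add: parseval flip: sum_distrib_left)
  finally have "a\<^sup>2 \<le> b * N"
    using a by (simp add: power3_eq_cube power2_eq_square)
  then have sq: "(a\<^sup>2)\<^sup>2 \<le> (b * N)\<^sup>2"
    by (intro power_mono) auto
  \<comment> \<open>All singleton coefficients are \<open>- b\<close>, and their squares form only
    part of the Parseval sum.\<close>
  have "card V * real b ^ 2 = (\<Sum>i\<in>V. (?g {i})\<^sup>2)"
    using fourier_coeff_singleton [OF fin up] b by simp
  also have "\<dots> = (\<Sum>S\<in>(\<lambda>i. {i}) ` V. (?g S)\<^sup>2)"
    by (subst sum.reindex) (auto simp: inj_on_def)
  also have "\<dots> \<le> (\<Sum>S\<in>Pow V. (?g S)\<^sup>2)"
    using V(1) by (intro sum_mono2) auto
  finally have nb: "card V * real b ^ 2 \<le> N * a"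
    using parseval by simp
  have "card V * a ^ 3 * a = card V * (a\<^sup>2)\<^sup>2"
    by (simp add: power3_eq_cube power2_eq_square)
  also have "\<dots> \<le> card V * (b * N)\<^sup>2"
    using sq by (rule mult_left_mono) simp
  also have "\<dots> = (card V * real b ^ 2) * N\<^sup>2"
    by (simp add: power_mult_distrib)
  also have "\<dots> \<le> (N * a) * N\<^sup>2"
    using nb by (rule mult_right_mono) simp
  also have "\<dots> = N ^ 3 * a"
    by (simp add: power3_eq_cube power2_eq_square)
  finally show ?thesis
    using a by (simp add: a_def N_def)
qed simp

section \<open>From a symmetric 3-wise intersecting family to its up-closure\<close>

lemma card_cube_le_of_symmetric_three_wise_intersecting:
  assumes A: "A \<subseteq> Pow {1..n}" "symmetric_family n A" "three_wise_intersecting A"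
  shows "real n * real (card A) ^ 3 \<le> (2 ^ n) ^ 3"
proof -
  \<comment> \<open>Passing to the up-closure cannot decrease the cardinality, and it keeps the
    automorphisms of \<open>A\<close>. It provides the monotonicity behind the influence
    bounds.\<close>
  define F where "F = {y. y \<subseteq> {1..n} \<and> (\<exists>x\<in>A. x \<subseteq> y)}"
  have F: "F \<subseteq> Pow {1..n}"
    by (auto simp: F_def)
  have "A \<subseteq> F"
    using A(1) by (auto simp: F_def)
  then have "card A \<le> card F"
    using finite_subset [OF F] by (intro card_mono) auto
  have "(`) \<sigma> ` F = F" if \<sigma>: "\<sigma> \<in> aut_family n A" for \<sigma>
  \<comment> \<open>Taking images under \<sigma> is injective and \<open>F\<close> is finite, so
    mapping \<open>F\<close> into itself already means mapping it onto itself.\<close>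
  proof (rule endo_inj_surj)
    show "finite F"
      using finite_subset [OF F] by simp
    have perm: "\<sigma> permutes {1..n}" and img: "(`) \<sigma> ` A = A"
      using \<sigma> by (simp_all add: aut_family_def)
    show "(`) \<sigma> ` F \<subseteq> F"
    proof
      fix z assume "z \<in> (`) \<sigma> ` F"
      then obtain x y where xy: "x \<in> A" "x \<subseteq> y" "y \<subseteq> {1..n}" "z = \<sigma> ` y"
        by (auto simp: F_def)
      have "\<sigma> ` x \<in> A"
        using xy(1) img by blast
      moreover have "\<sigma> ` y \<subseteq> {1..n}"
        using xy(3) permutes_image [OF perm] by blast
      ultimately show "z \<in> F"
        using image_mono [OF xy(2), of \<sigma>] xy(4) unfolding F_def by blast
    qed
    show "inj_on ((`) \<sigma>) F"
      using permutes_inj [OF perm] by (simp add: inj_on_def inj_image_eq_iff)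
  qed
  then have "card (pivotal F (\<sigma> i)) = card (pivotal F i)" if "\<sigma> \<in> aut_family n A" for \<sigma> i
    using that permutes_inj by (intro card_pivotal_aut) (auto simp: aut_family_def)
  then have "card (pivotal F j) = card (pivotal F i)" if "i \<in> {1..n}" "j \<in> {1..n}" for i j
    using A(2) that unfolding symmetric_family_def by metis
  then have "\<exists>b. \<forall>i\<in>{1..n}. card (pivotal F i) = b"
    by blast
  then obtain b where b: "\<And>i. i \<in> {1..n} \<Longrightarrow> card (pivotal F i) = b"
    by blast
  have "real (card {1..n}) * real (card F) ^ 3 \<le> (2 ^ card {1..n}) ^ 3"
  proof (rule card_cube_le_of_equal_influences [OF _ F _ _ b])
    show "insert i x \<in> F" if "x \<in> F" "i \<in> {1..n}" for x i
      using that unfolding F_def by blast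
    show "sym_diff x y \<notin> F" if "x \<in> F" "y \<in> F" for x y
    proof
      assume "sym_diff x y \<in> F"
      with that obtain u v w where uvw: "u \<in> A" "u \<subseteq> x" "v \<in> A" "v \<subseteq> y" "w \<in> A" "w \<subseteq> sym_diff x y"
        unfolding F_def by blast
      \<comment> \<open>\<open>u\<close> and \<open>v\<close> meet inside the intersection of
        \<open>x\<close> and \<open>y\<close>, which is disjoint from \<open>sym_diff x y\<close>
        and hence from \<open>w\<close>.\<close>
      then have "u \<inter> v \<inter> w = {}"
        by blast
      then show False
        using uvw A(3) unfolding three_wise_intersecting_def by blast
    qed
  qed simp_all
  moreover have "real n * real (card A) ^ 3 \<le> real n * real (card F) ^ 3"
    using \<open>card A \<le> card F\<close> by (intro mult_left_mono power_mono) auto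
  ultimately show ?thesis
    by simp
qed

theorem theorem1p2:
  shows "\<exists>c::real. c > 0 \<and>
    (\<forall>n::nat. n \<ge> 1 \<longrightarrow>
      (\<forall>A::nat set set. A \<subseteq> Pow {1..n} \<and> symmetric_family n A \<and> three_wise_intersecting A
        \<longrightarrow> real (card A) \<le> 2 ^ n / real n powr c))"
proof (intro exI conjI allI impI)
  \<comment> \<open>The exponent comes from taking cube roots in the cubic bound;
    \<open>n \<ge> 1\<close> makes \<open>r\<close>, the cube root of \<open>n\<close>, positive, so
    that it can be divided by.\<close>
  show "(1/3::real) > 0" by simp
  fix n :: nat and A :: "nat set set"
  assume n: "n \<ge> 1" and A: "A \<subseteq> Pow {1..n} \<and> symmetric_family n A \<and> three_wise_intersecting A"
  define r where "r = real n powr (1/3)"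
  have r: "r > 0" "r ^ 3 = real n"
    using n by (simp_all add: r_def powr_power)
  have "(real (card A) * r) ^ 3 \<le> (2 ^ n) ^ 3"
    using card_cube_le_of_symmetric_three_wise_intersecting [of A n] A r(2)
    by (simp add: power_mult_distrib mult.commute)
  then have "real (card A) * r \<le> 2 ^ n"
    using r(1) by (subst (asm) power_mono_iff) auto
  then show "real (card A) \<le> 2 ^ n / real n powr (1/3)"
    using r(1) by (simp add: r_def pos_le_divide_eq)
qed

end
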